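(* Consider the RoPE spherical self-attention flow on $(\mathbb{S}^{d-1})^n$, $d=2r$, with $n\ge2$, finite $\beta\ge0$, positions $p_1,\dots,p_n\in\mathbb{R}$ and frequencies $\omega_1,\dots,\omega_r\in\mathbb{R}$. Let $x^\star=(x^\star_{(1)},\dots,x^\star_{(r)})\in\mathbb{S}^{d-1}$ ($x^\star_{(\ell)}\in\mathbb{R}^2$) be a consensus point with plane energies $a_\ell=\|x^\star_{(\ell)}\|^2$, and let $$W_{ij}=\exp\Bigl(\beta\sum_{\ell=1}^ra_\ell\cos(\omega_\ell(p_i-p_j))\Bigr),\qquad D=\operatorname{diag}(W\mathbf 1),\qquad A=D^{-1}W .$$ Then $W\succeq0$ and $A$ is similar to $$S=D^{-1/2}WD^{-1/2}\succeq0.$$ Consequently, $$1=\lambda_1(A)>\lambda_2(A)\ge\cdots\ge\lambda_n(A)\ge0,\qquad \gamma(a)=1-\lambda_2(A)\in(0,1].$$ The tangent Jacobian of the flow at the consensus equilibrium $(x^\star,\dots,x^\star)$ is $(A-I_n)\otimes I_{d-1}$. If $\beta>0$, equality $\gamma(a)=1$ holds exactly when $$a_\ell>0\ \Longrightarrow\ \omega_\ell(p_i-p_j)\in2\pi\mathbb{Z}\ \text{ for all }i,j.$$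
   Context: Flow: token $i$ has state $x_i\in\mathbb{S}^{d-1}$. With the block rotation $R_p=\bigoplus_{\ell=1}^r\begin{pmatrix}\cos(\omega_\ell p)&-\sin(\omega_\ell p)\\ \sin(\omega_\ell p)&\cos(\omega_\ell p)\end{pmatrix}$, put $W_{ij}(x)=e^{\beta\langle R_{p_i}x_i,R_{p_j}x_j\rangle}$, $A_{ij}(x)=W_{ij}(x)/\sum_kW_{ik}(x)$, and $\dot x_i=\sum_{j=1}^nA_{ij}(x)(x_j-\langle x_i,x_j\rangle x_i)$. At the consensus state $(x^\star,\dots,x^\star)$, which is an equilibrium, $W(x)$ and $A(x)$ equal the matrices $W$ and $A$ of the claim. The tangent Jacobian is the derivative of the vector field at this equilibrium restricted to $(T_{x^\star}\mathbb{S}^{d-1})^n$, expressed in a common orthonormal basis of $T_{x^\star}\mathbb{S}^{d-1}$. $\mathbf 1$ is the all-ones vector, $\succeq0$ means symmetric positive semidefinite, and eigenvalues are listed with multiplicity in non-increasing order. *)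

theory Defs
  imports "HOL-Analysis.Analysis" "HOL-Computational_Algebra.Polynomial"
begin

section \<open>Matrices\<close>

definition diag_matrix :: "real^'n \<Rightarrow> real^'n^'n" where
  "diag_matrix v = (\<chi> i j. if i = j then v $ i else 0)"

definition psd :: "real^'n^'n \<Rightarrow> bool" where
  "psd M \<longleftrightarrow> transpose M = M \<and> (\<forall>v. 0 \<le> v \<bullet> (M *v v))"

definition similar_matrix :: "real^'n^'n \<Rightarrow> real^'n^'n \<Rightarrow> bool" where
  "similar_matrix A B \<longleftrightarrow> (\<exists>P. invertible P \<and> A = matrix_inv P ** B ** P)"

definition kronecker :: "real^'n^'n \<Rightarrow> real^'m^'m \<Rightarrow> real^('n \<times> 'm)^('n \<times> 'm)" where
  "kronecker A B = (\<chi> i j. A $ fst i $ fst j * B $ snd i $ snd j)"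

definition char_polynomial :: "real^'n^'n \<Rightarrow> real poly" where
  "char_polynomial A = det (\<chi> i j. (if i = j then [:0, 1:] else 0) - [:A $ i $ j:])"

text \<open>The real roots of the characteristic polynomial, with algebraic multiplicity. If their number
  is \<open>CARD('n)\<close>, then there are no others, so these are all the complex eigenvalues of \<open>A\<close>.\<close>

definition eigenvalues :: "real^'n^'n \<Rightarrow> real multiset" where
  "eigenvalues A = proots (char_polynomial A)"

text \<open>The \<open>k\<close>-th largest eigenvalue, counted from \<open>k = 1\<close>. It is meaningful only
  for \<open>1 \<le> k \<le> size (eigenvalues A)\<close>.\<close>

definition eigval :: "real^'n^'n \<Rightarrow> nat \<Rightarrow> real" where
  "eigval A k = rev (sorted_list_of_multiset (eigenvalues A)) ! (k - 1)"

section \<open>The flow\<close>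

text \<open>With \<open>r = CARD('r)\<close>, the space \<open>\<real>\<^sup>d\<close>, \<open>d = 2 r\<close>, is \<open>real^2^'r\<close> with its Euclidean
  norm, and \<open>x $ l\<close> is the component in the \<open>l\<close>-th plane. A configuration of
  \<open>n = CARD('n)\<close> tokens is a vector \<open>X\<close> whose entries \<open>X $ i\<close> are the token states.\<close>

definition rope_rotation :: "real^'r \<Rightarrow> real \<Rightarrow> real^2^'r \<Rightarrow> real^2^'r" where
  "rope_rotation \<omega> q x =
     (\<chi> l. vector [vector [cos (\<omega> $ l * q), - sin (\<omega> $ l * q)],
                   vector [sin (\<omega> $ l * q),   cos (\<omega> $ l * q)]] *v (x $ l))"

definition rope_W :: "real \<Rightarrow> real^'r \<Rightarrow> real^'n \<Rightarrow> real^2^'r^'n \<Rightarrow> real^'n^'n" where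
  "rope_W \<beta> \<omega> p X =
     (\<chi> i j. exp (\<beta> * (rope_rotation \<omega> (p $ i) (X $ i) \<bullet> rope_rotation \<omega> (p $ j) (X $ j))))"

definition rope_A :: "real \<Rightarrow> real^'r \<Rightarrow> real^'n \<Rightarrow> real^2^'r^'n \<Rightarrow> real^'n^'n" where
  "rope_A \<beta> \<omega> p X =
     (\<chi> i j. rope_W \<beta> \<omega> p X $ i $ j / (\<Sum>k\<in>UNIV. rope_W \<beta> \<omega> p X $ i $ k))"

definition rope_field :: "real \<Rightarrow> real^'r \<Rightarrow> real^'n \<Rightarrow> real^2^'r^'n \<Rightarrow> real^2^'r^'n" where
  "rope_field \<beta> \<omega> p X =
     (\<chi> i. \<Sum>j\<in>UNIV. rope_A \<beta> \<omega> p X $ i $ j *\<^sub>R (X $ j - (X $ i \<bullet> X $ j) *\<^sub>R X $ i))"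

section \<open>Tangent Jacobian at a consensus state\<close>

definition consensus :: "'v \<Rightarrow> 'v^'n" where
  "consensus x = (\<chi> i. x)"

definition sphere_tangent :: "'v::real_inner \<Rightarrow> 'v set" where
  "sphere_tangent x = {v. v \<bullet> x = 0}"

definition orthonormal_basis :: "('m \<Rightarrow> 'v::real_inner) \<Rightarrow> 'v set \<Rightarrow> bool" where
  "orthonormal_basis u T \<longleftrightarrow>
     (\<forall>k l. u k \<bullet> u l = (if k = l then 1 else 0)) \<and> span (range u) = T"

text \<open>\<open>J\<close> is the matrix of the derivative of \<open>F\<close> at the consensus state, restricted to the product
  of the tangent spaces, in the basis \<open>axis i (u k)\<close> (token \<open>i\<close> moves along \<open>u k\<close>, the others are
  fixed). In particular the derivative maps the product of the tangent spaces to itself. The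
  derivative is that of \<open>F\<close> on the ambient space; along tangent vectors it depends only on the
  values of \<open>F\<close> on the product of spheres.\<close>

definition is_tangent_jacobian ::
  "(('v::euclidean_space)^'n \<Rightarrow> 'v^'n) \<Rightarrow> 'v \<Rightarrow> ('m::finite \<Rightarrow> 'v) \<Rightarrow> real^('n \<times> 'm)^('n \<times> 'm) \<Rightarrow> bool" where
  "is_tangent_jacobian F x u J \<longleftrightarrow>
     orthonormal_basis u (sphere_tangent x) \<and>
     (\<exists>F'. (F has_derivative F') (at (consensus x)) \<and>
           (\<forall>j l. F' (axis j (u l)) = (\<Sum>i\<in>UNIV. \<Sum>k\<in>UNIV. J $ (i, k) $ (j, l) *\<^sub>R axis i (u k))))"

section \<open>The matrices of the consensus state\<close>

definition plane_energy :: "real^2^'r \<Rightarrow> real^'r" where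
  "plane_energy x = (\<chi> l. (norm (x $ l))\<^sup>2)"

definition cons_W :: "real \<Rightarrow> real^'r \<Rightarrow> real^'n \<Rightarrow> real^'r \<Rightarrow> real^'n^'n" where
  "cons_W \<beta> \<omega> p a = (\<chi> i j. exp (\<beta> * (\<Sum>l\<in>UNIV. a $ l * cos (\<omega> $ l * (p $ i - p $ j)))))"

definition cons_D :: "real \<Rightarrow> real^'r \<Rightarrow> real^'n \<Rightarrow> real^'r \<Rightarrow> real^'n^'n" where
  "cons_D \<beta> \<omega> p a = diag_matrix (cons_W \<beta> \<omega> p a *v 1)"

definition cons_A :: "real \<Rightarrow> real^'r \<Rightarrow> real^'n \<Rightarrow> real^'r \<Rightarrow> real^'n^'n" where
  "cons_A \<beta> \<omega> p a = matrix_inv (cons_D \<beta> \<omega> p a) ** cons_W \<beta> \<omega> p a"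

definition cons_D_inv_sqrt :: "real \<Rightarrow> real^'r \<Rightarrow> real^'n \<Rightarrow> real^'r \<Rightarrow> real^'n^'n" where
  "cons_D_inv_sqrt \<beta> \<omega> p a = diag_matrix (\<chi> i. (cons_D \<beta> \<omega> p a $ i $ i) powr (- 1 / 2))"

definition cons_S :: "real \<Rightarrow> real^'r \<Rightarrow> real^'n \<Rightarrow> real^'r \<Rightarrow> real^'n^'n" where
  "cons_S \<beta> \<omega> p a = cons_D_inv_sqrt \<beta> \<omega> p a ** cons_W \<beta> \<omega> p a ** cons_D_inv_sqrt \<beta> \<omega> p a"

definition spectral_gap :: "real \<Rightarrow> real^'r \<Rightarrow> real^'n \<Rightarrow> real^'r \<Rightarrow> real" where
  "spectral_gap \<beta> \<omega> p a = 1 - eigval (cons_A \<beta> \<omega> p a) 2"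

lemma inner_rope_rotation:
  "rope_rotation \<omega> s x \<bullet> rope_rotation \<omega> t x
     = (\<Sum>l\<in>UNIV. plane_energy x $ l * cos (\<omega> $ l * (s - t)))"
proof -
  have "rope_rotation \<omega> s x $ l \<bullet> rope_rotation \<omega> t x $ l
          = plane_energy x $ l * cos (\<omega> $ l * (s - t))" for l
    by (simp add: rope_rotation_def plane_energy_def power2_norm_eq_inner inner_vec_def
        matrix_vector_mult_def sum_2 vector_2 right_diff_distrib cos_diff algebra_simps)
  then show ?thesis
    by (subst inner_vec_def) simp
qed

lemma rope_W_consensus: "rope_W \<beta> \<omega> p (consensus x) = cons_W \<beta> \<omega> p (plane_energy x)"
  by (simp add: rope_W_def cons_W_def consensus_def inner_rope_rotation)

lemma rope_A_consensus:
  fixes p :: "real^'n"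
  shows "rope_A \<beta> \<omega> p (consensus x) = cons_A \<beta> \<omega> p (plane_energy x)"
proof -
  define W where "W = cons_W \<beta> \<omega> p (plane_energy x)"
  define v where "v = W *v 1"
  define E where "E = diag_matrix (\<chi> i. 1 / v $ i)"
  have v: "v $ i = (\<Sum>k\<in>UNIV. W $ i $ k)" for i
    by (simp add: v_def matrix_vector_mult_def)
  have v0: "v $ i \<noteq> 0" for i
  proof -
    have "0 < v $ i"
      unfolding v by (intro sum_pos) (auto simp: W_def cons_W_def)
    then show ?thesis by simp
  qed
  have dm: "diag_matrix w ** M = (\<chi> i j. w $ i * M $ i $ j)" for w and M :: "real^'n^'n"
    by (simp add: diag_matrix_def matrix_matrix_mult_def if_distrib[where f = "\<lambda>z. z * _"] cong: if_cong)
  have "E ** diag_matrix v = mat 1"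
    unfolding E_def dm by (auto simp: diag_matrix_def mat_def vec_eq_iff v0)
  moreover have "diag_matrix v ** E = mat 1"
    unfolding dm by (auto simp: E_def diag_matrix_def mat_def vec_eq_iff v0)
  ultimately have E: "E ** diag_matrix v = mat 1 \<and> diag_matrix v ** E = mat 1"
    by simp
  then have "diag_matrix v ** matrix_inv (diag_matrix v) = mat 1"
    unfolding matrix_inv_def by (rule someI2[where a = E, OF conj_commute[THEN iffD1]]) simp
  then have "matrix_inv (diag_matrix v) = E"
    using E by (metis matrix_mul_assoc matrix_mul_lid matrix_mul_rid)
  then show ?thesis
    by (simp add: rope_A_def rope_W_consensus cons_A_def cons_D_def W_def[symmetric] v_def[symmetric]
        E_def dm v)
qed

end

theory Submission
  imports Defs
begin

text \<open>The argument rests on three observations.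

  Spectrum. The matrix \<open>W\<close> is the entrywise exponential of a Gram matrix, that of the vectors
  \<open>sqrt \<beta> *\<^sub>R R\<^sub>p x\<close>, where \<open>p\<close> runs over the positions. Entrywise powers of a Gram matrix are positive
  semidefinite by the Schur product theorem, and the exponential series passes this on to \<open>W\<close>
  (\<open>psd_exp_gram\<close>). The congruent matrix \<open>S = D\<^sup>-\<^sup>1\<^sup>/\<^sup>2 W D\<^sup>-\<^sup>1\<^sup>/\<^sup>2\<close> inherits this, and it is similar to
  \<open>A = D\<^sup>-\<^sup>1 W\<close> through \<open>D\<^sup>1\<^sup>/\<^sup>2\<close>. By the spectral theorem (\<open>symmetric_matrix_similar_diagonal\<close>) \<open>S\<close>, and
  with it \<open>A\<close>, is similar to a diagonal matrix, whose entries are non-negative and are the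
  eigenvalues of \<open>A\<close> with multiplicity. On the other hand \<open>A\<close> has positive entries and row sums \<open>1\<close>,
  and a maximum principle shows that \<open>1\<close> is its largest eigenvalue and is simple
  (\<open>positive_stochastic_spectrum\<close>).

  Maximal gap. Since the eigenvalues are non-negative and one of them is \<open>1\<close>, the second one vanishes
  exactly if the trace of \<open>A\<close> is \<open>1\<close>. The plane energies have sum \<open>1\<close>, so the diagonal entries of
  \<open>W\<close> are \<open>exp \<beta>\<close> and no entry is larger. Hence every diagonal entry of \<open>A\<close> is at least \<open>1 / n\<close>, and the
  trace is \<open>1\<close> exactly if all entries of \<open>W\<close> are \<open>exp \<beta>\<close>
  (\<open>sum_diagonal_over_row_sum_eq_1_iff\<close>). For \<open>\<beta> > 0\<close> this says that a weighted mean of cosines with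
  weights \<open>a\<close> is \<open>1\<close> for all pairs of tokens, so each cosine with positive weight is \<open>1\<close>.

  Jacobian. The velocity of token \<open>i\<close> is a combination, with the attention weights, of brackets
  that vanish at consensus. By the product rule only the brackets contribute to the derivative
  (\<open>consensus_attention_derivative\<close>), and on tangent vectors their combination is \<open>A - I\<close> acting on
  the token index.\<close>

section \<open>The spectral theorem\<close>

text \<open>Let \<open>e\<close> maximize \<open>y \<bullet> f y\<close> over the unit sphere of \<open>V\<close>, and let \<open>c\<close> be the maximum. Then
  \<open>g = c - f\<close> has a non-negative quadratic form on \<open>V\<close> that vanishes at \<open>e\<close>. A non-negative
  form has derivative zero at such a point, and \<open>w = g e\<close> lies in \<open>V\<close>, so moving from \<open>e\<close> a little
  in the direction \<open>- w\<close> would make the form negative unless \<open>w = 0\<close>.\<close>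

lemma self_adjoint_eigenvector:
  fixes f :: "'a::euclidean_space \<Rightarrow> 'a"
  assumes lin: "linear f" and sa: "\<And>x y. f x \<bullet> y = x \<bullet> f y"
    and V: "subspace V" "f ` V \<subseteq> V" "V \<noteq> {0}"
  obtains c e where "e \<in> V" "norm e = 1" "f e = c *\<^sub>R e"
proof -
  define K where "K = sphere 0 1 \<inter> V"
  have "compact K"
    unfolding K_def by (intro compact_Int_closed closed_subspace V) simp
  moreover have "K \<noteq> {}"
  proof -
    obtain y where y: "y \<in> V" "y \<noteq> 0"
      using V(3) subspace_0[OF V(1)] by blast
    then have "y /\<^sub>R norm y \<in> K"
      using V by (simp add: K_def subspace_scale)
    then show ?thesis by auto
  qed
  moreover have "continuous_on K (\<lambda>y. y \<bullet> f y)"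
    using lin by (intro continuous_intros linear_continuous_on) (simp add: linear_conv_bounded_linear)
  ultimately obtain e where e: "e \<in> K" "\<And>y. y \<in> K \<Longrightarrow> y \<bullet> f y \<le> e \<bullet> f e"
    using continuous_attains_sup by metis
  define c where "c = e \<bullet> f e"
  define g where "g = (\<lambda>y. c *\<^sub>R y - f y)"
  have eV: "e \<in> V" and ne: "norm e = 1" using e by (auto simp: K_def)
  then have ee: "e \<bullet> e = 1" by (simp add: dot_square_norm)
  have g_lin: "g (y + t *\<^sub>R z) = g y + t *\<^sub>R g z" for y z t
    unfolding g_def using linear_add[OF lin] linear_scale[OF lin] by (simp add: algebra_simps)
  have g_sa: "g y \<bullet> z = y \<bullet> g z" for y z
    by (simp add: g_def sa inner_diff_left inner_diff_right)
  have g_nonneg: "0 \<le> y \<bullet> g y" if y: "y \<in> V" for y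
  proof (cases "y = 0")
    case False
    then have "y /\<^sub>R norm y \<in> K" using V y by (simp add: K_def subspace_scale)
    from e(2)[OF this] have "y \<bullet> f y / (norm y)\<^sup>2 \<le> c"
      by (simp add: c_def linear_scale[OF lin] power2_eq_square divide_inverse mult.commute mult.left_commute)
    then show ?thesis
      using False by (simp add: g_def inner_diff_right dot_square_norm pos_divide_le_eq)
  qed simp
  define w where "w = g e"
  have wV: "w \<in> V"
    using eV V by (auto simp: w_def g_def intro!: subspace_diff subspace_scale)
  have "w \<bullet> w = 0"
  proof (rule ccontr)
    assume "w \<bullet> w \<noteq> 0"
    define s where "s = w \<bullet> w"
    define b where "b = w \<bullet> g w"
    \<comment> \<open>At \<open>e + t *\<^sub>R w\<close> the form of \<open>g\<close> is \<open>2 * t * s + t\<^sup>2 * b\<close>; this \<open>t\<close> makes it negative also if \<open>b = 0\<close>.\<close>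
    define u where "u = s / (b + 1)"
    define t where "t = - u"
    have b: "0 \<le> b" using g_nonneg[OF wV] by (simp add: b_def)
    have s: "s = u * (b + 1)" using b by (simp add: u_def)
    have u: "u \<noteq> 0" using \<open>w \<bullet> w \<noteq> 0\<close> b by (simp add: s_def u_def)
    have "e + t *\<^sub>R w \<in> V" using eV wV V by (simp add: subspace_add subspace_scale)
    then have "0 \<le> (e + t *\<^sub>R w) \<bullet> g (e + t *\<^sub>R w)" by (rule g_nonneg)
    also have "\<dots> = e \<bullet> g e + t * (e \<bullet> g w) + t * (w \<bullet> g e) + t * t * b"
      by (simp add: g_lin inner_add_left inner_add_right b_def algebra_simps)
    also have "e \<bullet> g e = 0" by (simp add: g_def inner_diff_right ee c_def)
    also have "e \<bullet> g w = s" by (simp add: g_sa[symmetric] w_def s_def)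
    also have "w \<bullet> g e = s" by (simp add: w_def s_def)
    also have "0 + t * s + t * s + t * t * b = - (u * u * (b + 2))"
      by (simp add: t_def s algebra_simps)
    also have "\<dots> < 0"
      using b u by (simp add: zero_less_mult_iff linorder_neq_iff disj_commute)
    finally show False by simp
  qed
  then have "f e = c *\<^sub>R e" by (simp add: w_def g_def)
  with eV ne show thesis by (rule that)
qed

text \<open>The orthogonal complement of an eigenvector inside an invariant subspace is again invariant, so
  one eigenvector can be split off at a time, by induction on the dimension.\<close>

lemma self_adjoint_orthonormal_eigenbasis:
  fixes f :: "'a::euclidean_space \<Rightarrow> 'a"
  assumes lin: "linear f" and sa: "\<And>x y. f x \<bullet> y = x \<bullet> f y"
  shows "subspace V \<Longrightarrow> f ` V \<subseteq> V \<Longrightarrow>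
    \<exists>B. pairwise orthogonal B \<and> (\<forall>e\<in>B. norm e = 1 \<and> (\<exists>c. f e = c *\<^sub>R e)) \<and> span B = V"
proof (induction "dim V" arbitrary: V rule: less_induct)
  case less
  show ?case
  proof (cases "V = {0}")
    case True
    then show ?thesis by (intro exI[of _ "{}"]) auto
  next
    case False
    obtain c e where e: "e \<in> V" "norm e = 1" "f e = c *\<^sub>R e"
      using self_adjoint_eigenvector[OF lin sa less.prems False] by blast
    have ee: "e \<bullet> e = 1" using e by (simp add: dot_square_norm)
    define U where "U = {y \<in> V. e \<bullet> y = 0}"
    have U: "subspace U"
      using less.prems by (auto simp: U_def subspace_def inner_add_right)
    have fU: "f ` U \<subseteq> U"
    proof (intro image_subsetI)
      fix y assume y: "y \<in> U"
      then have "e \<bullet> f y = 0" by (simp add: U_def sa[symmetric] e)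
      then show "f y \<in> U" using y less.prems by (auto simp: U_def)
    qed
    have "e \<notin> U" using ee by (simp add: U_def)
    moreover have "U \<subseteq> V" by (auto simp: U_def)
    ultimately have "U \<subset> V" using e(1) by blast
    then have "dim U < dim V"
      using U less.prems by (intro dim_psubset) (simp add: span_eq_iff[THEN iffD2])
    then obtain B where B: "pairwise orthogonal B"
      "\<forall>e\<in>B. norm e = 1 \<and> (\<exists>c. f e = c *\<^sub>R e)" "span B = U"
      using less.hyps[OF _ U fU] by blast
    have BU: "B \<subseteq> U" using B(3) span_superset by blast
    have "pairwise orthogonal (insert e B)"
      using B(1) BU by (auto simp: pairwise_insert orthogonal_def U_def inner_commute)
    moreover have "span (insert e B) = V"
    proof
      show "span (insert e B) \<subseteq> V"
        using BU \<open>U \<subset> V\<close> e less.prems by (intro span_minimal) auto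
      show "V \<subseteq> span (insert e B)"
      proof
        fix y assume y: "y \<in> V"
        have "y - (e \<bullet> y) *\<^sub>R e \<in> span B"
          using y e ee less.prems
          by (simp add: B(3) U_def inner_diff_right subspace_diff subspace_scale)
        then show "y \<in> span (insert e B)"
          by (auto simp: span_insert)
      qed
    qed
    ultimately show ?thesis
      using B(2) e by (intro exI[of _ "insert e B"]) auto
  qed
qed

section \<open>Similar matrices\<close>

text \<open>This form of similarity avoids the inverse matrix in all calculations below.\<close>

lemma similar_matrix_iff: "similar_matrix A B \<longleftrightarrow> (\<exists>P. invertible P \<and> P ** A = B ** P)"
proof -
  have "A = matrix_inv P ** B ** P \<longleftrightarrow> P ** A = B ** P" if "invertible P" for P
  proof -
    have inv: "P ** matrix_inv P = mat 1 \<and> matrix_inv P ** P = mat 1"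
      using that unfolding matrix_inv_def invertible_def by (rule someI_ex)
    show ?thesis
    proof
      assume "A = matrix_inv P ** B ** P"
      then have "P ** A = (P ** matrix_inv P) ** B ** P" by (simp only: matrix_mul_assoc)
      then show "P ** A = B ** P" by (simp add: inv)
    next
      assume "P ** A = B ** P"
      then have "matrix_inv P ** B ** P = (matrix_inv P ** P) ** A"
        by (simp only: matrix_mul_assoc[symmetric])
      then show "A = matrix_inv P ** B ** P" by (simp add: inv)
    qed
  qed
  then show ?thesis unfolding similar_matrix_def by blast
qed

lemma similar_matrix_trans:
  assumes "similar_matrix A B" "similar_matrix B C"
  shows "similar_matrix A C"
proof -
  obtain P where P: "invertible P" "P ** A = B ** P"
    using assms(1) by (auto simp: similar_matrix_iff)
  obtain Q where Q: "invertible Q" "Q ** B = C ** Q"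
    using assms(2) by (auto simp: similar_matrix_iff)
  have "(Q ** P) ** A = Q ** B ** P"
    by (simp only: P(2) matrix_mul_assoc[symmetric])
  also have "\<dots> = C ** (Q ** P)"
    by (simp only: Q(2) matrix_mul_assoc[symmetric])
  finally show ?thesis
    using P Q invertible_mult unfolding similar_matrix_iff by blast
qed

lemma diag_matrix_mul: "diag_matrix v ** M = (\<chi> i j. v $ i * M $ i $ j)"
  by (simp add: diag_matrix_def matrix_matrix_mult_def if_distrib[where f = "\<lambda>z. z * _"] cong: if_cong)

lemma mul_diag_matrix: "M ** diag_matrix v = (\<chi> i j. M $ i $ j * v $ j)"
  by (simp add: diag_matrix_def matrix_matrix_mult_def if_distrib[where f = "\<lambda>z. _ * z"] cong: if_cong)

text \<open>The rows of the conjugating matrix \<open>P\<close> are an orthonormal eigenbasis of \<open>M\<close>.\<close>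

theorem symmetric_matrix_similar_diagonal:
  fixes M :: "real^'n^'n"
  assumes sym: "transpose M = M"
  shows "\<exists>\<mu>. similar_matrix M (diag_matrix \<mu>)"
proof -
  have sa: "(M *v y) \<bullet> z = y \<bullet> (M *v z)" for y z
    using dot_lmul_matrix[of y M z] by (simp add: transpose_matrix_vector[symmetric] sym)
  obtain B where B: "pairwise orthogonal B" "\<forall>e\<in>B. norm e = 1 \<and> (\<exists>c. M *v e = c *\<^sub>R e)"
    "span B = (UNIV :: (real^'n) set)"
    using self_adjoint_orthonormal_eigenbasis[OF matrix_vector_mul_linear sa subspace_UNIV] by auto
  have ind: "independent B"
    using B by (intro pairwise_orthogonal_independent) auto
  have "card B = CARD('n)"
    using dim_span_eq_card_independent[OF ind] B(3) by simp
  then obtain q where q: "bij_betw q (UNIV :: 'n set) B"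
    using bij_betw_iff_card[of "UNIV :: 'n set" B] independent_imp_finite[OF ind] by auto
  have qB: "q i \<in> B" for i using q by (auto simp: bij_betw_def)
  have qq: "q i \<bullet> q j = (if i = j then 1 else 0)" for i j
  proof (cases "i = j")
    case True
    then show ?thesis using B(2) qB by (simp add: dot_square_norm)
  next
    case False
    then have "q i \<noteq> q j" using q by (auto simp: bij_betw_def inj_on_def)
    then show ?thesis using B(1) qB False by (auto simp: pairwise_def orthogonal_def)
  qed
  have "\<forall>i. \<exists>c. M *v q i = c *\<^sub>R q i" using B(2) qB by blast
  from choice[OF this] obtain \<mu> where \<mu>: "\<And>i. M *v q i = \<mu> i *\<^sub>R q i"
    by blast
  define P where "P = (\<chi> i. q i)"
  have "(P ** transpose P) $ i $ j = q i \<bullet> q j" for i j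
    by (simp add: P_def matrix_matrix_mult_def transpose_def inner_vec_def)
  then have "P ** transpose P = mat 1"
    by (simp add: vec_eq_iff mat_def qq)
  then have "invertible P" by (auto simp: invertible_right_inverse)
  moreover have "P ** M = diag_matrix (\<chi> i. \<mu> i) ** P"
  proof -
    have "(P ** M) $ i $ j = \<mu> i * q i $ j" for i j
    proof -
      have "(P ** M) $ i $ j = (transpose M *v q i) $ j"
        by (simp add: P_def matrix_matrix_mult_def matrix_vector_mult_def transpose_def mult.commute)
      then show ?thesis by (simp add: sym \<mu>)
    qed
    then show ?thesis by (simp add: diag_matrix_mul vec_eq_iff P_def)
  qed
  ultimately show ?thesis by (auto simp: similar_matrix_iff)
qed

text \<open>Evaluation at every \<open>t\<close> determines a real polynomial, so this reduces questions on
  determinants over the polynomial ring to determinants over the reals.\<close>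

lemma poly_char_polynomial: "poly (char_polynomial A) t = det (mat t - A)"
  unfolding char_polynomial_def det_def
  by (simp add: poly_sum poly_prod mat_def poly_mult, intro sum.cong refl arg_cong2[where f = "(*)"] prod.cong)
     (auto simp: sign_def)

lemma mat_scalar_commute: "mat t ** P = P ** mat (t::real)"
  by (simp add: mat_def matrix_matrix_mult_def vec_eq_iff if_distrib[where f = "\<lambda>z. z * _"]
      if_distrib[where f = "\<lambda>z. _ * z"] mult.commute cong: if_cong)

lemma similar_matrix_char_polynomial:
  assumes "similar_matrix A B"
  shows "char_polynomial A = char_polynomial B"
proof -
  obtain P where P: "invertible P" "P ** A = B ** P"
    using assms by (auto simp: similar_matrix_iff)
  have "det P * det (mat t - A) = det P * det (mat t - B)" for t
  proof -
    have "P ** (mat t - A) = P ** mat t - P ** A"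
      by (simp add: matrix_matrix_mult_def vec_eq_iff right_diff_distrib sum_subtractf)
    also have "\<dots> = mat t ** P - B ** P"
      by (simp add: mat_scalar_commute P(2))
    also have "\<dots> = (mat t - B) ** P"
      by (simp add: matrix_matrix_mult_def vec_eq_iff left_diff_distrib sum_subtractf)
    finally have "P ** (mat t - A) = (mat t - B) ** P" .
    from arg_cong[where f = det, OF this] show ?thesis
      by (simp add: det_mul mult.commute)
  qed
  then have "poly (char_polynomial A) = poly (char_polynomial B)"
    using P(1) by (auto simp: poly_char_polynomial invertible_det_nz)
  then show ?thesis by (rule poly_eq_poly_eq_iff[THEN iffD1])
qed

lemma similar_matrix_trace:
  assumes "similar_matrix A B"
  shows "trace A = trace B"
proof -
  obtain P Q where P: "P ** A = B ** P" "P ** Q = mat 1" "Q ** P = mat 1"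
    using assms by (auto simp: similar_matrix_iff invertible_def)
  have "A = Q ** (B ** P)" by (simp add: P(3) P(1)[symmetric] matrix_mul_assoc)
  then have "trace A = trace (B ** P ** Q)" by (metis trace_mul_sym)
  also have "B ** P ** Q = B" by (simp only: matrix_mul_assoc[symmetric] P matrix_mul_rid)
  finally show ?thesis .
qed

lemma eigenvalues_similar_diagonal:
  fixes A :: "real^'n^'n"
  assumes "similar_matrix A (diag_matrix \<mu>)"
  shows "eigenvalues A = image_mset (($) \<mu>) (mset_set UNIV)"
proof -
  have "poly (char_polynomial (diag_matrix \<mu>)) t = poly (\<Prod>i\<in>UNIV. [:- \<mu> $ i, 1:]) t" for t
    by (simp add: poly_char_polynomial diag_matrix_def mat_def det_diagonal poly_prod)
  then have "char_polynomial A = (\<Prod>i\<in>UNIV. [:- \<mu> $ i, 1:])"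
    using similar_matrix_char_polynomial[OF assms] poly_eq_poly_eq_iff by (metis ext)
  then have "eigenvalues A = (\<Sum>i\<in>UNIV. {#\<mu> $ i#})"
    by (simp add: eigenvalues_def proots_prod)
  then show ?thesis by (simp add: sum_unfold_sum_mset)
qed

text \<open>The columns of the inverse of a diagonalizing matrix are eigenvectors.\<close>

lemma similar_diagonal_eigenbasis:
  fixes A :: "real^'n^'n"
  assumes "similar_matrix A (diag_matrix \<mu>)"
  obtains Q where "invertible Q" "A ** Q = Q ** diag_matrix \<mu>"
    "\<And>i. A *v column i Q = \<mu> $ i *s column i Q" "\<And>i. column i Q \<noteq> 0"
proof -
  obtain P Q where P: "P ** A = diag_matrix \<mu> ** P" "P ** Q = mat 1" "Q ** P = mat 1"
    using assms by (auto simp: similar_matrix_iff invertible_def)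
  have AQ: "A ** Q = Q ** diag_matrix \<mu>"
  proof -
    have "A ** Q = Q ** (P ** A) ** Q" by (simp add: matrix_mul_assoc P(3))
    also have "\<dots> = Q ** diag_matrix \<mu> ** (P ** Q)" by (simp only: P(1) matrix_mul_assoc)
    finally show ?thesis by (simp add: P(2))
  qed
  have "column i Q \<noteq> 0" for i
  proof
    assume "column i Q = 0"
    then have "(P ** Q) $ i $ i = 0"
      by (simp add: column_def matrix_matrix_mult_def vec_eq_iff)
    then show False by (simp add: P(2) mat_def)
  qed
  moreover have "A *v column i Q = \<mu> $ i *s column i Q" for i
  proof -
    have "(A *v column i Q) $ k = (Q ** diag_matrix \<mu>) $ k $ i" for k
      by (simp only: AQ[symmetric]) (simp add: column_def matrix_matrix_mult_def matrix_vector_mult_def)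
    then show ?thesis by (simp add: mul_diag_matrix vec_eq_iff column_def mult.commute)
  qed
  moreover have "invertible Q" using P by (auto simp: invertible_def)
  ultimately show thesis using AQ by (blast intro: that)
qed

section \<open>Positive stochastic matrices\<close>

text \<open>Compare absolute values in the row where the eigenvector has its entry of largest absolute
  value: the other side is an average of entries that are no larger.\<close>

lemma positive_stochastic_eigenvalue_le_1:
  fixes A :: "real^'n^'n"
  assumes pos: "\<And>i j. 0 < A $ i $ j" and row: "\<And>i. (\<Sum>j\<in>UNIV. A $ i $ j) = 1"
    and eig: "A *v v = c *s v" "v \<noteq> 0"
  shows "c \<le> 1"
proof -
  have "finite (range (\<lambda>i. \<bar>v $ i\<bar>))" by simp
  then obtain i where i: "\<And>j. \<bar>v $ j\<bar> \<le> \<bar>v $ i\<bar>"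
    using Max_in[of "range (\<lambda>i. \<bar>v $ i\<bar>)"] Max_ge[of "range (\<lambda>i. \<bar>v $ i\<bar>)"] by fastforce
  have "v $ i \<noteq> 0"
    using i eig(2) by (metis abs_le_zero_iff abs_zero vec_eq_iff zero_index)
  have "c * v $ i = (\<Sum>j\<in>UNIV. A $ i $ j * v $ j)"
    using eig(1) by (simp add: vec_eq_iff matrix_vector_mult_def)
  then have "\<bar>c\<bar> * \<bar>v $ i\<bar> \<le> (\<Sum>j\<in>UNIV. \<bar>A $ i $ j * v $ j\<bar>)"
    by (metis abs_mult sum_abs)
  also have "\<dots> \<le> (\<Sum>j\<in>UNIV. A $ i $ j * \<bar>v $ i\<bar>)"
    using pos i by (intro sum_mono) (simp add: abs_mult less_imp_le mult_left_mono)
  also have "\<dots> = \<bar>v $ i\<bar>"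
    by (simp add: sum_distrib_right[symmetric] row)
  finally show ?thesis using \<open>v $ i \<noteq> 0\<close> by simp
qed

text \<open>Maximum principle: in the row of the largest entry, that entry is an average with positive
  weights of entries that are no larger, so all entries agree with it.\<close>

lemma positive_stochastic_fixed_vector_constant:
  fixes A :: "real^'n^'n"
  assumes pos: "\<And>i j. 0 < A $ i $ j" and row: "\<And>i. (\<Sum>j\<in>UNIV. A $ i $ j) = 1"
    and fixed: "A *v v = v"
  shows "\<exists>c. v = c *s 1"
proof -
  have "finite (range (($) v))" by simp
  then obtain i where i: "\<And>j. v $ j \<le> v $ i"
    using Max_in[of "range (($) v)"] Max_ge[of "range (($) v)"] by fastforce
  have "(\<Sum>j\<in>UNIV. A $ i $ j * (v $ i - v $ j)) = v $ i - (A *v v) $ i"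
    by (simp add: right_diff_distrib sum_subtractf sum_distrib_right[symmetric] row matrix_vector_mult_def)
  also have "\<dots> = 0" by (simp add: fixed)
  finally have "\<forall>j\<in>UNIV. A $ i $ j * (v $ i - v $ j) = 0"
    using pos i by (subst (asm) sum_nonneg_eq_0_iff) (auto simp: less_imp_le)
  then have "v $ j = v $ i" for j
    using pos[of i j] by (metis UNIV_I eq_iff_diff_eq_0 less_irrefl mult_eq_0_iff)
  then have "v = (v $ i) *s 1" by (simp add: vec_eq_iff)
  then show ?thesis ..
qed

text \<open>The part of the Perron--Frobenius theorem that is needed here: \<open>1\<close> is a simple eigenvalue, and the
  largest one. The all-ones vector is fixed, so \<open>1\<close> occurs on the diagonal. If it occurred twice, two
  columns of the diagonalizing matrix would be fixed vectors, hence both constant, and the matrix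
  would not be invertible.\<close>

lemma positive_stochastic_spectrum:
  fixes A :: "real^'n^'n"
  assumes pos: "\<And>i j. 0 < A $ i $ j" and row: "\<And>i. (\<Sum>j\<in>UNIV. A $ i $ j) = 1"
    and sim: "similar_matrix A (diag_matrix \<mu>)"
  obtains k where "\<mu> $ k = 1" "\<And>i. i \<noteq> k \<Longrightarrow> \<mu> $ i < 1"
proof -
  obtain Q where Q: "invertible Q" "A ** Q = Q ** diag_matrix \<mu>"
    "\<And>i. A *v column i Q = \<mu> $ i *s column i Q" "\<And>i. column i Q \<noteq> 0"
    using similar_diagonal_eigenbasis[OF sim] by blast
  obtain P where P: "Q ** P = mat 1" "P ** Q = mat 1"
    using Q(1) by (auto simp: invertible_def)
  \<comment> \<open>The coordinates of the all-ones vector in the eigenbasis; one of them is not zero.\<close>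
  define w where "w = P *v 1"
  have Qw: "Q *v w = 1" by (simp add: w_def matrix_vector_mul_assoc P)
  have "w \<noteq> 0" using Qw by auto
  then obtain k where k: "w $ k \<noteq> 0" by (auto simp: vec_eq_iff)
  have "A *v 1 = 1" by (simp add: matrix_vector_mult_def row vec_eq_iff)
  then have "w = P *v (A *v (Q *v w))" unfolding Qw by (simp add: w_def)
  also have "\<dots> = diag_matrix \<mu> *v w"
    by (simp add: matrix_vector_mul_assoc Q(2)) (simp add: matrix_mul_assoc P)
  finally have "w $ k = \<mu> $ k * w $ k"
    by (simp add: diag_matrix_def matrix_vector_mult_def vec_eq_iff if_distrib[where f = "\<lambda>z. z * _"] cong: if_cong)
  then have k1: "\<mu> $ k = 1" using k by simp
  moreover have "\<mu> $ i < 1" if "i \<noteq> k" for i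
  proof (rule ccontr)
    assume "\<not> \<mu> $ i < 1"
    moreover have "\<mu> $ i \<le> 1"
      using positive_stochastic_eigenvalue_le_1[OF pos row Q(3,4)] .
    ultimately have i1: "\<mu> $ i = 1" by simp
    obtain c where c: "column k Q = c *s 1"
      using positive_stochastic_fixed_vector_constant[OF pos row] Q(3)[of k] k1 by auto
    obtain d where d: "column i Q = d *s 1"
      using positive_stochastic_fixed_vector_constant[OF pos row] Q(3)[of i] i1 by auto
    have "(P ** Q) $ j $ k = c * (P *v 1) $ j" "(P ** Q) $ j $ i = d * (P *v 1) $ j" for j
      using c d by (simp_all add: column_def vec_eq_iff matrix_matrix_mult_def matrix_vector_mult_def
          sum_distrib_left mult.commute)
    \<comment> \<open>Two columns of the identity matrix cannot be multiples of the same vector.\<close>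
    from this(1)[of k] this(2)[of i] this(1)[of i] show False
      using that by (auto simp: P mat_def)
  qed
  ultimately show thesis by (rule that)
qed

text \<open>The eigenvalue \<open>1\<close> exceeds all others, so it is the head of the descending list of eigenvalues, and
  the tail \<open>R\<close> lists the others. The second eigenvalue bounds the tail from above and the tail is
  non-negative; therefore it is zero exactly if the tail has sum zero. This turns the condition
  \<open>\<lambda>\<^sub>2 = 0\<close> into one on the trace.\<close>

lemma eigval_simple_top:
  fixes A :: "real^'n^'n" and \<mu> :: "real^'n"
  assumes card: "CARD('n) \<ge> 2"
    and eig: "eigenvalues A = image_mset (($) \<mu>) (mset_set UNIV)"
    and top: "\<mu> $ m = 1" "\<And>i. i \<noteq> m \<Longrightarrow> 0 \<le> \<mu> $ i \<and> \<mu> $ i < 1"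
  shows "size (eigenvalues A) = CARD('n)" "eigval A 1 = 1" "eigval A 2 < 1"
    "\<And>k. 2 \<le> k \<Longrightarrow> k < CARD('n) \<Longrightarrow> eigval A (Suc k) \<le> eigval A k"
    "\<And>k. 2 \<le> k \<Longrightarrow> k \<le> CARD('n) \<Longrightarrow> 0 \<le> eigval A k"
    "eigval A 2 = 0 \<longleftrightarrow> (\<Sum>i\<in>UNIV. \<mu> $ i) = 1"
proof -
  define N where "N = image_mset (($) \<mu>) (mset_set (UNIV - {m}))"
  define R where "R = rev (sorted_list_of_multiset N)"
  have "mset_set UNIV = add_mset m (mset_set (UNIV - {m}))"
    by (intro mset_set.remove) simp_all
  then have M: "eigenvalues A = add_mset 1 N"
    by (simp add: eig N_def top(1))
  have set_N: "set_mset N = ($) \<mu> ` (UNIV - {m})"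
    by (simp add: N_def)
  have "rev (sorted_list_of_multiset (eigenvalues A)) = 1 # R"
    unfolding M R_def using top(2) set_N
    by (subst sorted_list_of_multiset_insert, subst sorted_insort_is_snoc) (auto intro: less_imp_le)
  then have eigval: "eigval A k = (1 # R) ! (k - 1)" for k
    by (simp add: eigval_def)
  have len: "length R = CARD('n) - 1"
    by (simp add: R_def N_def size_mset[symmetric] del: size_mset)
  have set_R: "set R = ($) \<mu> ` (UNIV - {m})"
    by (simp add: R_def set_N)
  have mono: "R ! j \<le> R ! i" if "i \<le> j" "j < length R" for i j
    using that by (intro sorted_rev_nth_mono) (simp_all add: R_def)
  have R_range: "0 \<le> R ! i \<and> R ! i < 1" if "i < length R" for i
    using nth_mem[OF that] set_R top(2) by auto
  show "size (eigenvalues A) = CARD('n)" by (simp add: eig)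
  show "eigval A 1 = 1" by (simp add: eigval)
  show "eigval A 2 < 1" using R_range[of 0] card by (simp add: eigval len)
  show "eigval A (Suc k) \<le> eigval A k" if "2 \<le> k" "k < CARD('n)" for k
    using that mono[of "k - 2" "k - 1"] by (simp add: eigval len nth_Cons' numeral_2_eq_2)
  show "0 \<le> eigval A k" if "2 \<le> k" "k \<le> CARD('n)" for k
    using that R_range[of "k - 2"] by (simp add: eigval len nth_Cons' numeral_2_eq_2)
  have "eigval A 2 = 0 \<longleftrightarrow> (\<forall>i<length R. R ! i = 0)"
    using card mono[of 0] R_range by (fastforce simp: eigval len)
  also have "\<dots> \<longleftrightarrow> (\<forall>r\<in>set R. r = 0)"
    by (simp only: all_set_conv_all_nth)
  also have "\<dots> \<longleftrightarrow> (\<forall>i\<in>UNIV - {m}. \<mu> $ i = 0)"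
    unfolding set_R by blast
  also have "\<dots> \<longleftrightarrow> (\<Sum>i\<in>UNIV - {m}. \<mu> $ i) = 0"
    using top(2) by (subst sum_nonneg_eq_0_iff) auto
  also have "\<dots> \<longleftrightarrow> (\<Sum>i\<in>UNIV. \<mu> $ i) = 1"
    by (simp add: sum.remove[of UNIV m] top(1))
  finally show "eigval A 2 = 0 \<longleftrightarrow> (\<Sum>i\<in>UNIV. \<mu> $ i) = 1" .
qed

section \<open>Positive semidefinite matrices\<close>

lemma psd_iff:
  "psd M \<longleftrightarrow> (\<forall>i j. M $ i $ j = M $ j $ i) \<and>
    (\<forall>v. 0 \<le> (\<Sum>i\<in>UNIV. \<Sum>j\<in>UNIV. v i * v j * M $ i $ j))"
proof -
  have "v \<bullet> (M *v v) = (\<Sum>i\<in>UNIV. \<Sum>j\<in>UNIV. v $ i * v $ j * M $ i $ j)" for v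
    by (simp add: inner_vec_def matrix_vector_mult_def sum_distrib_left mult_ac)
  then have "(\<forall>v. 0 \<le> v \<bullet> (M *v v)) \<longleftrightarrow>
      (\<forall>v. 0 \<le> (\<Sum>i\<in>UNIV. \<Sum>j\<in>UNIV. v i * v j * M $ i $ j))"
    by (metis (no_types, lifting) sum.cong vec_lambda_beta)
  then show ?thesis
    by (auto simp: psd_def transpose_def vec_eq_iff)
qed

lemma psd_quadratic_form_nonneg:
  "psd M \<Longrightarrow> 0 \<le> (\<Sum>i\<in>UNIV. \<Sum>j\<in>UNIV. v i * v j * M $ i $ j)"
  unfolding psd_iff by (elim conjE allE)

text \<open>The Schur product theorem for a product with a Gram matrix. Expanding the inner product in
  coordinates writes the quadratic form at \<open>v\<close> as a sum, over the coordinates \<open>b\<close>, of the form of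
  \<open>M\<close> at the vectors with entries \<open>v i * (y i \<bullet> b)\<close>.\<close>

lemma psd_mult_gram:
  fixes y :: "'n::finite \<Rightarrow> 'v::euclidean_space"
  assumes "psd M"
  shows "psd (\<chi> i j. M $ i $ j * (y i \<bullet> y j))"
proof -
  have "0 \<le> (\<Sum>i\<in>UNIV. \<Sum>j\<in>UNIV. v i * v j * (M $ i $ j * (y i \<bullet> y j)))" for v :: "'n \<Rightarrow> real"
  proof -
    have "0 \<le> (\<Sum>b\<in>Basis. \<Sum>i\<in>UNIV. \<Sum>j\<in>UNIV. (v i * (y i \<bullet> b)) * (v j * (y j \<bullet> b)) * M $ i $ j)"
      using assms by (intro sum_nonneg psd_quadratic_form_nonneg)
    also have "\<dots> = (\<Sum>i\<in>UNIV. \<Sum>j\<in>UNIV. \<Sum>b\<in>Basis. (v i * (y i \<bullet> b)) * (v j * (y j \<bullet> b)) * M $ i $ j)"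
      by (subst sum.swap, rule sum.cong[OF refl], subst sum.swap, rule refl)
    also have "\<dots> = (\<Sum>i\<in>UNIV. \<Sum>j\<in>UNIV. v i * v j * (M $ i $ j * (y i \<bullet> y j)))"
      by (subst euclidean_inner) (simp add: sum_distrib_left mult_ac)
    finally show ?thesis .
  qed
  with assms show ?thesis by (simp add: psd_iff inner_commute)
qed

lemma psd_gram_power:
  fixes y :: "'n::finite \<Rightarrow> 'v::euclidean_space"
  shows "psd (\<chi> i j. (y i \<bullet> y j) ^ k)"
proof (induction k)
  case 0
  have "(\<Sum>i\<in>UNIV. \<Sum>j\<in>UNIV. v i * v j) = (\<Sum>i\<in>UNIV. v i) * (\<Sum>i\<in>UNIV. v i)" for v :: "'n \<Rightarrow> real"
    by (simp add: sum_product)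
  then show ?case by (simp add: psd_iff)
next
  case (Suc k)
  from psd_mult_gram[OF this, of y] show ?case by (simp add: mult.commute)
qed

text \<open>Every term of the exponential series is a non-negative multiple of an entrywise power.\<close>

lemma psd_exp_gram:
  fixes y :: "'n::finite \<Rightarrow> 'v::euclidean_space"
  shows "psd (\<chi> i j. exp (y i \<bullet> y j))"
proof -
  have "0 \<le> (\<Sum>i\<in>UNIV. \<Sum>j\<in>UNIV. v i * v j * exp (y i \<bullet> y j))" for v :: "'n \<Rightarrow> real"
  proof (rule sums_le[OF _ sums_zero])
    show "(\<lambda>k. \<Sum>i\<in>UNIV. \<Sum>j\<in>UNIV. v i * v j * ((y i \<bullet> y j) ^ k /\<^sub>R fact k))
            sums (\<Sum>i\<in>UNIV. \<Sum>j\<in>UNIV. v i * v j * exp (y i \<bullet> y j))"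
      by (intro sums_sum sums_mult exp_converges)
    fix k
    have "0 \<le> (\<Sum>i\<in>UNIV. \<Sum>j\<in>UNIV. v i * v j * (y i \<bullet> y j) ^ k) /\<^sub>R fact k"
      using psd_gram_power[of y k] by (simp add: psd_iff)
    then show "0 \<le> (\<Sum>i\<in>UNIV. \<Sum>j\<in>UNIV. v i * v j * ((y i \<bullet> y j) ^ k /\<^sub>R fact k))"
      by (simp add: sum_distrib_left mult_ac)
  qed
  then show ?thesis by (simp add: psd_iff inner_commute)
qed

lemma psd_diag_congruence:
  assumes "psd M"
  shows "psd (diag_matrix e ** M ** diag_matrix e)"
proof -
  have "0 \<le> (\<Sum>i\<in>UNIV. \<Sum>j\<in>UNIV. (v i * e $ i) * (v j * e $ j) * M $ i $ j)" for v
    using assms by (rule psd_quadratic_form_nonneg)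
  moreover have "M $ i $ j = M $ j $ i" for i j
    using assms by (simp add: psd_iff)
  ultimately show ?thesis by (simp add: psd_iff diag_matrix_mul mul_diag_matrix mult_ac)
qed

lemma psd_similar_diagonal_nonneg:
  assumes "psd M" "similar_matrix M (diag_matrix \<mu>)"
  shows "0 \<le> \<mu> $ i"
proof -
  obtain Q where Q: "M *v column i Q = \<mu> $ i *s column i Q" "column i Q \<noteq> 0"
    using similar_diagonal_eigenbasis[OF assms(2)] by metis
  have "0 \<le> column i Q \<bullet> (M *v column i Q)" using assms(1) by (simp add: psd_def)
  then have "0 \<le> \<mu> $ i * (column i Q \<bullet> column i Q)" by (simp add: Q(1) scalar_mult_eq_scaleR)
  moreover have "0 < column i Q \<bullet> column i Q" using Q(2) by simp
  ultimately show ?thesis by (simp add: zero_le_mult_iff)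
qed

section \<open>The Jacobian at a consensus state\<close>

lemma has_derivative_vec_componentwise:
  fixes f :: "'a::euclidean_space \<Rightarrow> 'b::euclidean_space^'n"
  assumes "\<And>i. ((\<lambda>x. f x $ i) has_derivative (\<lambda>h. f' h $ i)) (at x)"
  shows "(f has_derivative f') (at x)"
proof (subst has_derivative_componentwise_within, rule ballI)
  fix e :: "'b^'n" assume "e \<in> Basis"
  then obtain i b where e: "e = axis i b" by (auto simp: Basis_vec_def)
  show "((\<lambda>x. f x \<bullet> e) has_derivative (\<lambda>h. f' h \<bullet> e)) (at x)"
    unfolding e inner_axis by (intro has_derivative_inner_left assms)
qed

text \<open>The bracket \<open>X $ j - (X $ i \<bullet> X $ j) *\<^sub>R X $ i\<close> vanishes at the consensus state of a unit vector, so
  by the product rule the derivative of the attention weights \<open>\<alpha>\<close> does not enter. This is why the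
  Jacobian depends on the weights at the consensus state only.\<close>

lemma consensus_attention_derivative:
  fixes \<alpha> :: "'v::euclidean_space^'n \<Rightarrow> real^'n^'n"
  assumes x: "norm x = 1"
    and \<alpha>: "\<And>i j. (\<lambda>X. \<alpha> X $ i $ j) differentiable (at (consensus x))"
  shows "((\<lambda>X. \<chi> i. \<Sum>j\<in>UNIV. \<alpha> X $ i $ j *\<^sub>R (X $ j - (X $ i \<bullet> X $ j) *\<^sub>R X $ i)) has_derivative
    (\<lambda>H. \<chi> i. \<Sum>j\<in>UNIV. \<alpha> (consensus x) $ i $ j *\<^sub>R
           (H $ j - (x \<bullet> H $ j + H $ i \<bullet> x) *\<^sub>R x - H $ i))) (at (consensus x))"
proof (rule has_derivative_vec_componentwise, simp only: vec_lambda_beta, rule has_derivative_sum)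
  fix i j
  have nth: "((\<lambda>X::'v^'n. X $ k) has_derivative (\<lambda>H. H $ k)) (at (consensus x))" for k
    by (rule bounded_linear_imp_has_derivative[OF bounded_linear_vec_nth])
  obtain \<alpha>' where \<alpha>': "((\<lambda>X. \<alpha> X $ i $ j) has_derivative \<alpha>') (at (consensus x))"
    using \<alpha> by (auto simp: differentiable_def)
  have xx: "x \<bullet> x = 1" using x by (simp add: dot_square_norm)
  have "((\<lambda>X. X $ j - (X $ i \<bullet> X $ j) *\<^sub>R X $ i) has_derivative
      (\<lambda>H. H $ j - (x \<bullet> H $ j + H $ i \<bullet> x) *\<^sub>R x - H $ i)) (at (consensus x))"
    by (rule has_derivative_eq_rhs,
        rule has_derivative_diff[OF nth has_derivative_scaleR[OF has_derivative_inner[OF nth nth] nth]])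
       (simp add: consensus_def xx algebra_simps)
  from has_derivative_scaleR[OF \<alpha>' this]
  show "((\<lambda>X. \<alpha> X $ i $ j *\<^sub>R (X $ j - (X $ i \<bullet> X $ j) *\<^sub>R X $ i)) has_derivative
      (\<lambda>H. \<alpha> (consensus x) $ i $ j *\<^sub>R
        (H $ j - (x \<bullet> H $ j + H $ i \<bullet> x) *\<^sub>R x - H $ i))) (at (consensus x))"
    by (simp add: consensus_def xx)
qed

lemma linear_rope_rotation: "linear (rope_rotation \<omega> q)"
  by (rule linearI) (simp_all add: rope_rotation_def vec_eq_iff matrix_vector_right_distrib
      matrix_vector_mult_scaleR)

lemma differentiable_rope_A:
  fixes p :: "real^'n" and X0 :: "real^2^'r^'n"
  shows "(\<lambda>X. rope_A \<beta> \<omega> p X $ i $ j) differentiable (at X0)"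
proof -
  have rot: "(\<lambda>X::real^2^'r^'n. rope_rotation \<omega> (p $ k) (X $ k)) differentiable (at X0)" for k
  proof -
    have "bounded_linear (rope_rotation \<omega> (p $ k))"
      using linear_rope_rotation linear_conv_bounded_linear by blast
    from bounded_linear_compose[OF this bounded_linear_vec_nth] show ?thesis
      by (rule bounded_linear_imp_differentiable)
  qed
  have W: "(\<lambda>X. rope_W \<beta> \<omega> p X $ k $ l) differentiable (at X0)" for k l
  proof -
    obtain f g where
      "((\<lambda>X. rope_rotation \<omega> (p $ k) (X $ k)) has_derivative f) (at X0)"
      "((\<lambda>X. rope_rotation \<omega> (p $ l) (X $ l)) has_derivative g) (at X0)"
      using rot[of k] rot[of l] by (auto simp: differentiable_def)
    from has_derivative_exp[OF has_derivative_mult_right[OF has_derivative_inner[OF this]]]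
    show ?thesis by (auto simp: rope_W_def differentiable_def)
  qed
  moreover have "(\<Sum>k\<in>UNIV. rope_W \<beta> \<omega> p X0 $ i $ k) \<noteq> 0"
  proof -
    have "0 < (\<Sum>k\<in>UNIV. rope_W \<beta> \<omega> p X0 $ i $ k)"
      by (intro sum_pos) (auto simp: rope_W_def)
    then show ?thesis by simp
  qed
  ultimately show ?thesis
    unfolding rope_A_def vec_lambda_beta by (intro differentiable_divide differentiable_sum) auto
qed

lemma orthonormal_basis_card:
  fixes u :: "'m::finite \<Rightarrow> 'v::euclidean_space"
  assumes "orthonormal_basis u T"
  shows "CARD('m) = dim T"
proof -
  have u: "u k \<bullet> u l = (if k = l then 1 else 0)" for k l
    using assms by (simp add: orthonormal_basis_def)
  have "inj u"
  proof (rule injI)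
    fix k l assume "u k = u l"
    then show "k = l" using u[of k l] u[of l l] by (simp split: if_splits)
  qed
  have "u k \<noteq> 0" for k using u[of k k] by auto
  then have "independent (range u)"
    by (intro pairwise_orthogonal_independent) (auto simp: pairwise_def orthogonal_def u)
  then have "dim (span (range u)) = card (range u)"
    by (rule dim_span_eq_card_independent)
  also have "card (range u) = CARD('m)"
    using \<open>inj u\<close> by (rule card_image)
  finally show ?thesis
    using assms unfolding orthonormal_basis_def by metis
qed

lemma dim_sphere_tangent:
  fixes x :: "'v::euclidean_space"
  assumes "x \<noteq> 0"
  shows "dim (sphere_tangent x) = DIM('v) - 1"
  using dim_hyperplane[OF assms] by (simp add: sphere_tangent_def inner_commute)

lemma cons_A_nth:
  fixes p :: "real^'n"
  assumes "a = plane_energy x"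
  shows "cons_A \<beta> \<omega> p a $ i $ j = cons_W \<beta> \<omega> p a $ i $ j / (\<Sum>k\<in>UNIV. cons_W \<beta> \<omega> p a $ i $ k)"
  unfolding assms rope_A_consensus[symmetric] by (simp add: rope_A_def rope_W_consensus)

lemma sum_cons_W_pos: "0 < (\<Sum>k\<in>UNIV. cons_W \<beta> \<omega> p a $ i $ k)"
  by (intro sum_pos) (auto simp: cons_W_def)

lemma cons_A_row_sum:
  fixes p :: "real^'n"
  assumes "a = plane_energy x"
  shows "(\<Sum>j\<in>UNIV. cons_A \<beta> \<omega> p a $ i $ j) = 1"
  using sum_cons_W_pos[of \<beta> \<omega> p a i]
  by (simp add: cons_A_nth[OF assms] sum_divide_distrib[symmetric])

text \<open>For tangent perturbations \<open>H\<close> the inner products with \<open>x\<close> drop out, and because the rows of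
  \<open>A\<close> have sum \<open>1\<close> the derivative in token \<open>i\<close> becomes \<open>(\<Sum>k. A $ i $ k *\<^sub>R H $ k) - H $ i\<close>. This acts on
  the token index by \<open>A - I\<close> and as the identity on the tangent space.\<close>

lemma tangent_jacobian_consensus:
  fixes p :: "real^'n" and x :: "real^2^'r" and u :: "'m::finite \<Rightarrow> real^2^'r"
  assumes x: "norm x = 1" and u: "orthonormal_basis u (sphere_tangent x)"
  shows "is_tangent_jacobian (rope_field \<beta> \<omega> p) x u
    (kronecker (cons_A \<beta> \<omega> p (plane_energy x) - mat 1) (mat 1))"
proof -
  define A where "A = cons_A \<beta> \<omega> p (plane_energy x)"
  define F' where "F' = (\<lambda>H :: real^2^'r^'n. \<chi> i. \<Sum>j\<in>UNIV. A $ i $ j *\<^sub>R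
    (H $ j - (x \<bullet> H $ j + H $ i \<bullet> x) *\<^sub>R x - H $ i))"
  have deriv: "(rope_field \<beta> \<omega> p has_derivative F') (at (consensus x))"
    using consensus_attention_derivative[OF x differentiable_rope_A, of \<beta> \<omega> p]
    unfolding rope_field_def[abs_def] F'_def A_def rope_A_consensus .
  have tangent: "u l \<bullet> x = 0" for l
  proof -
    have "u l \<in> span (range u)" by (simp add: span_base)
    then show ?thesis using u by (simp add: orthonormal_basis_def sphere_tangent_def)
  qed
  have "F' (axis j (u l)) =
      (\<Sum>i\<in>UNIV. \<Sum>k\<in>UNIV. kronecker (A - mat 1) (mat 1) $ (i, k) $ (j, l) *\<^sub>R axis i (u k))" for j l
  proof -
    have "F' (axis j (u l)) $ i = (A - mat 1) $ i $ j *\<^sub>R u l" for i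
    proof -
      define H where "H = axis j (u l)"
      have H: "H $ k = (if k = j then u l else 0)" for k
        by (simp add: H_def axis_def)
      have "x \<bullet> H $ k = 0" "H $ k \<bullet> x = 0" for k
        by (simp_all add: H tangent inner_commute[of x])
      then have "F' H $ i = (\<Sum>k\<in>UNIV. A $ i $ k *\<^sub>R (H $ k - H $ i))"
        by (simp add: F'_def)
      also have "\<dots> = (\<Sum>k\<in>UNIV. A $ i $ k *\<^sub>R H $ k) - H $ i"
        using cons_A_row_sum[OF refl, of \<beta> \<omega> p x i]
        by (simp add: scaleR_diff_right sum_subtractf scaleR_sum_left[symmetric] A_def)
      also have "(\<Sum>k\<in>UNIV. A $ i $ k *\<^sub>R H $ k) = A $ i $ j *\<^sub>R u l"
        by (simp add: H if_distrib[where f = "\<lambda>z. _ *\<^sub>R z"] cong: if_cong)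
      finally show ?thesis
        by (cases "i = j") (simp_all add: H_def[symmetric] H mat_def algebra_simps)
    qed
    moreover have "(\<Sum>i\<in>UNIV. \<Sum>k\<in>UNIV. kronecker (A - mat 1) (mat 1) $ (i, k) $ (j, l) *\<^sub>R axis i (u k)) $ i
        = (A - mat 1) $ i $ j *\<^sub>R u l" for i
    proof -
      have "(\<Sum>k\<in>UNIV. kronecker (A - mat 1) (mat 1) $ (i', k) $ (j, l) *\<^sub>R axis i' (u k)) =
          (A - mat 1) $ i' $ j *\<^sub>R axis i' (u l)" for i'
        by (simp add: kronecker_def mat_def if_distrib[where f = "\<lambda>z. _ * z"]
            if_distrib[where f = "\<lambda>z. z *\<^sub>R _"] cong: if_cong)
      then show ?thesis
        by (simp add: axis_def if_distrib[where f = "\<lambda>z. _ *\<^sub>R z"] cong: if_cong)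
    qed
    ultimately show ?thesis by (simp add: vec_eq_iff)
  qed
  with deriv u show ?thesis
    unfolding is_tangent_jacobian_def A_def[symmetric] by blast
qed

section \<open>The consensus matrices\<close>

text \<open>The exponents are the inner products of the rotated copies of \<open>x\<close>, scaled by \<open>sqrt \<beta>\<close>.\<close>

lemma psd_cons_W:
  fixes p :: "real^'n"
  assumes "0 \<le> \<beta>"
  shows "psd (cons_W \<beta> \<omega> p (plane_energy x))"
proof -
  define y where "y = (\<lambda>i. sqrt \<beta> *\<^sub>R rope_rotation \<omega> (p $ i) x)"
  have "y i \<bullet> y j = \<beta> * (\<Sum>l\<in>UNIV. plane_energy x $ l * cos (\<omega> $ l * (p $ i - p $ j)))" for i j
    using assms by (simp add: y_def inner_rope_rotation mult.assoc[symmetric])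
  with psd_exp_gram[of y] show ?thesis by (simp add: cons_W_def)
qed

text \<open>The conjugating matrix is \<open>P = D\<^sup>1\<^sup>/\<^sup>2\<close>: both products \<open>P ** A\<close> and \<open>S ** P\<close> equal \<open>D\<^sup>-\<^sup>1\<^sup>/\<^sup>2 ** W\<close>.\<close>

lemma cons_A_similar_cons_S:
  fixes p :: "real^'n"
  assumes "a = plane_energy x"
  shows "similar_matrix (cons_A \<beta> \<omega> p a) (cons_S \<beta> \<omega> p a)"
proof -
  define W where "W = cons_W \<beta> \<omega> p a"
  define d where "d i = (\<Sum>k\<in>UNIV. W $ i $ k)" for i
  have d: "0 < d i" for i
    unfolding d_def W_def by (rule sum_cons_W_pos)
  have E: "cons_D_inv_sqrt \<beta> \<omega> p a = diag_matrix (\<chi> i. 1 / sqrt (d i))"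
    using d by (simp add: cons_D_inv_sqrt_def cons_D_def diag_matrix_def matrix_vector_mult_def
        W_def[symmetric] d_def[symmetric] powr_minus_divide powr_half_sqrt less_imp_le vec_eq_iff)
  define P where "P = diag_matrix (\<chi> i. sqrt (d i))"
  define P' where "P' = diag_matrix (\<chi> i. 1 / sqrt (d i))"
  have "P ** P' = mat 1"
    unfolding P_def diag_matrix_mul using d
    by (auto simp: P'_def diag_matrix_def mat_def vec_eq_iff less_imp_neq[symmetric])
  then have "invertible P" by (auto simp: invertible_right_inverse)
  moreover have "P ** cons_A \<beta> \<omega> p a = cons_S \<beta> \<omega> p a ** P"
  proof -
    have "(P ** cons_A \<beta> \<omega> p a) $ i $ j = (cons_S \<beta> \<omega> p a ** P) $ i $ j" for i j
    proof -
      have "(P ** cons_A \<beta> \<omega> p a) $ i $ j = sqrt (d i) * (W $ i $ j / d i)"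
        by (simp add: P_def diag_matrix_mul cons_A_nth[OF assms] W_def d_def)
      also have "\<dots> = 1 / sqrt (d i) * W $ i $ j * (1 / sqrt (d j)) * sqrt (d j)"
        using d[of i] d[of j] by (simp add: field_simps)
      also have "\<dots> = (cons_S \<beta> \<omega> p a ** P) $ i $ j"
        by (simp add: P_def cons_S_def E diag_matrix_mul mul_diag_matrix W_def)
      finally show ?thesis .
    qed
    then show ?thesis by (simp add: vec_eq_iff)
  qed
  ultimately show ?thesis by (auto simp: similar_matrix_iff)
qed

text \<open>A row with \<open>n\<close> entries, all at most \<open>c\<close>, has sum at most \<open>n * c\<close>, so each summand on the left is at
  least \<open>1 / n\<close>. A total of \<open>1\<close> forces equality in each of these bounds.\<close>

lemma sum_diagonal_over_row_sum_eq_1_iff: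
  fixes W :: "real^'n^'n"
  assumes pos: "\<And>i j. 0 < W $ i $ j" and diag: "\<And>i. W $ i $ i = c" and le: "\<And>i j. W $ i $ j \<le> c"
  shows "(\<Sum>i\<in>UNIV. W $ i $ i / (\<Sum>k\<in>UNIV. W $ i $ k)) = 1 \<longleftrightarrow> (\<forall>i j. W $ i $ j = c)"
proof -
  define n where "n = real CARD('n)"
  define d where "d = (\<lambda>i. \<Sum>k\<in>UNIV. W $ i $ k)"
  have n: "0 < n" by (simp add: n_def)
  have d: "0 < d i" for i unfolding d_def by (intro sum_pos pos) auto
  have gap: "n * c - d i = (\<Sum>k\<in>UNIV. c - W $ i $ k)" for i
    by (simp add: d_def n_def sum_subtractf)
  have "d i \<le> n * c" for i
    using sum_nonneg[of UNIV "\<lambda>k. c - W $ i $ k"] le gap[of i] by simp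
  then have t: "0 \<le> c / d i - 1 / n" for i
    using d n by (simp add: field_simps)
  have "(\<Sum>i\<in>UNIV. W $ i $ i / d i) = 1 \<longleftrightarrow> (\<Sum>i\<in>UNIV. c / d i - 1 / n) = 0"
    by (simp add: diag sum_subtractf n_def)
  also have "\<dots> \<longleftrightarrow> (\<forall>i. c / d i - 1 / n = 0)"
    using t by (subst sum_nonneg_eq_0_iff) auto
  also have "\<dots> \<longleftrightarrow> (\<forall>i. n * c - d i = 0)"
    using d n by (intro arg_cong[where f = All] ext) (simp add: field_simps less_imp_neq[symmetric])
  also have "\<dots> \<longleftrightarrow> (\<forall>i j. W $ i $ j = c)"
    unfolding gap using le by (subst sum_nonneg_eq_0_iff) auto
  finally show ?thesis by (simp add: d_def)
qed

lemma sum_plane_energy: "(\<Sum>l\<in>UNIV. plane_energy x $ l) = (norm x)\<^sup>2"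
  by (simp add: plane_energy_def power2_norm_eq_inner inner_vec_def)

text \<open>The deficit \<open>1 - (\<Sum>l. a l * cos (\<theta> l))\<close> is the sum of the non-negative terms \<open>a l * (1 - cos (\<theta> l))\<close>.\<close>

lemma weighted_cos_eq_1_iff:
  fixes a \<theta> :: "real^'r"
  assumes a: "\<And>l. 0 \<le> a $ l" "(\<Sum>l\<in>UNIV. a $ l) = 1"
  shows "(\<Sum>l\<in>UNIV. a $ l * cos (\<theta> $ l)) \<le> 1"
    "(\<Sum>l\<in>UNIV. a $ l * cos (\<theta> $ l)) = 1 \<longleftrightarrow>
       (\<forall>l. a $ l > 0 \<longrightarrow> (\<exists>m::int. \<theta> $ l = 2 * pi * of_int m))"
proof -
  have eq: "1 - (\<Sum>l\<in>UNIV. a $ l * cos (\<theta> $ l)) = (\<Sum>l\<in>UNIV. a $ l * (1 - cos (\<theta> $ l)))"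
    by (simp add: right_diff_distrib sum_subtractf a(2))
  have nonneg: "0 \<le> a $ l * (1 - cos (\<theta> $ l))" for l
    using a(1) by simp
  show "(\<Sum>l\<in>UNIV. a $ l * cos (\<theta> $ l)) \<le> 1"
    using eq sum_nonneg[of UNIV "\<lambda>l. a $ l * (1 - cos (\<theta> $ l))"] nonneg by simp
  have "(\<Sum>l\<in>UNIV. a $ l * cos (\<theta> $ l)) = 1 \<longleftrightarrow> (\<Sum>l\<in>UNIV. a $ l * (1 - cos (\<theta> $ l))) = 0"
    using eq by linarith
  also have "\<dots> \<longleftrightarrow> (\<forall>l. a $ l * (1 - cos (\<theta> $ l)) = 0)"
    using nonneg by (subst sum_nonneg_eq_0_iff) auto
  also have "\<dots> \<longleftrightarrow> (\<forall>l. a $ l > 0 \<longrightarrow> cos (\<theta> $ l) = 1)"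
    using a(1) by (auto simp: less_le) 
  also have "\<dots> \<longleftrightarrow> (\<forall>l. a $ l > 0 \<longrightarrow> (\<exists>m::int. \<theta> $ l = 2 * pi * of_int m))"
    by (simp add: cos_one_2pi_int mult_ac)
  finally show "(\<Sum>l\<in>UNIV. a $ l * cos (\<theta> $ l)) = 1 \<longleftrightarrow>
       (\<forall>l. a $ l > 0 \<longrightarrow> (\<exists>m::int. \<theta> $ l = 2 * pi * of_int m))" .
qed

section \<open>Spectrum, spectral gap and Jacobian\<close>

theorem theorem7p3:
  fixes \<beta> :: real
    and p :: "real^'n"
    and \<omega> :: "real^'r"
    and x :: "real^2^'r"
    and a :: "real^'r"
    and W A S :: "real^'n^'n"
  assumes "CARD('n) \<ge> 2"
    and "\<beta> \<ge> 0"
    and "x \<in> sphere 0 1"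
    and "a = plane_energy x"
    and "W = cons_W \<beta> \<omega> p a"
    and "A = cons_A \<beta> \<omega> p a"
    and "S = cons_S \<beta> \<omega> p a"
  shows "psd W \<and> similar_matrix A S \<and> psd S \<and>
    (size (eigenvalues A) = CARD('n) \<and>
     eigval A 1 = 1 \<and> eigval A 2 < 1 \<and>
     (\<forall>k. 2 \<le> k \<and> k < CARD('n) \<longrightarrow> eigval A (Suc k) \<le> eigval A k) \<and>
     0 \<le> eigval A (CARD('n))) \<and>
    spectral_gap \<beta> \<omega> p a \<in> {0<..1} \<and>
    rope_field \<beta> \<omega> p (consensus x) = 0 \<and>
    (\<forall>u :: 'm::finite \<Rightarrow> real^2^'r. orthonormal_basis u (sphere_tangent x) \<longrightarrow>
       CARD('m) = 2 * CARD('r) - 1 \<and>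
       is_tangent_jacobian (rope_field \<beta> \<omega> p) x u (kronecker (A - mat 1) (mat 1))) \<and>
    (\<beta> > 0 \<longrightarrow>
       (spectral_gap \<beta> \<omega> p a = 1 \<longleftrightarrow>
        (\<forall>l. a $ l > 0 \<longrightarrow>
           (\<forall>i j. \<exists>m::int. \<omega> $ l * (p $ i - p $ j) = 2 * pi * of_int m))))"
proof -
  have x: "norm x = 1" and "x \<noteq> 0" using assms(3) by auto
  have a: "0 \<le> a $ l" for l by (simp add: assms(4) plane_energy_def)
  have sum_a: "(\<Sum>l\<in>UNIV. a $ l) = 1" by (simp add: assms(4) sum_plane_energy x)
  have psdW: "psd W" unfolding assms(4,5) using assms(2) by (rule psd_cons_W)
  have psdS: "psd S"
    using psd_diag_congruence[OF psdW] by (simp add: assms(5,7) cons_S_def cons_D_inv_sqrt_def)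
  have simAS: "similar_matrix A S"
    unfolding assms(6,7) by (rule cons_A_similar_cons_S[OF assms(4)])
  obtain \<mu> where S\<mu>: "similar_matrix S (diag_matrix \<mu>)"
    using symmetric_matrix_similar_diagonal psdS unfolding psd_def by blast
  have A\<mu>: "similar_matrix A (diag_matrix \<mu>)"
    using similar_matrix_trans[OF simAS S\<mu>] .
  have A_nth: "A $ i $ j = W $ i $ j / (\<Sum>k\<in>UNIV. W $ i $ k)" for i j
    unfolding assms(5,6) by (rule cons_A_nth[OF assms(4)])
  have Wpos: "0 < W $ i $ j" for i j by (simp add: assms(5) cons_W_def)
  then have Apos: "0 < A $ i $ j" for i j
    unfolding A_nth by (intro divide_pos_pos sum_pos) auto
  have row: "(\<Sum>j\<in>UNIV. A $ i $ j) = 1" for i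
    unfolding assms(6) by (rule cons_A_row_sum[OF assms(4)])
  obtain m where m: "\<mu> $ m = 1" "\<And>i. i \<noteq> m \<Longrightarrow> \<mu> $ i < 1"
    using positive_stochastic_spectrum[OF Apos row A\<mu>] by blast
  have top: "0 \<le> \<mu> $ i \<and> \<mu> $ i < 1" if "i \<noteq> m" for i
    using psd_similar_diagonal_nonneg[OF psdS S\<mu>] m(2)[OF that] by simp
  note eigval = eigval_simple_top[OF assms(1) eigenvalues_similar_diagonal[OF A\<mu>] m(1) top]

  \<comment> \<open>The trace of \<open>A\<close>, computed from its eigenvalues and from its diagonal.\<close>
  have "trace (diag_matrix \<mu>) = (\<Sum>i\<in>UNIV. \<mu> $ i)"
    by (simp add: trace_def diag_matrix_def)
  then have trace: "(\<Sum>i\<in>UNIV. \<mu> $ i) = (\<Sum>i\<in>UNIV. W $ i $ i / (\<Sum>k\<in>UNIV. W $ i $ k))"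
    using similar_matrix_trace[OF A\<mu>] by (simp add: trace_def A_nth)
  define c where "c i j = (\<Sum>l\<in>UNIV. a $ l * cos (\<omega> $ l * (p $ i - p $ j)))" for i j
  have W: "W $ i $ j = exp (\<beta> * c i j)" for i j
    by (simp add: assms(5) cons_W_def c_def)
  have c_le: "c i j \<le> 1" for i j
    using weighted_cos_eq_1_iff(1)[OF a sum_a, of "\<chi> l. \<omega> $ l * (p $ i - p $ j)"] by (simp add: c_def)
  have c_eq: "c i j = 1 \<longleftrightarrow> (\<forall>l. a $ l > 0 \<longrightarrow> (\<exists>m::int. \<omega> $ l * (p $ i - p $ j) = 2 * pi * of_int m))" for i j
    using weighted_cos_eq_1_iff(2)[OF a sum_a, of "\<chi> l. \<omega> $ l * (p $ i - p $ j)"] by (simp add: c_def)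
  have gap: "spectral_gap \<beta> \<omega> p a = 1 - eigval A 2"
    by (simp add: spectral_gap_def assms(6))
  have gap_eq_1: "spectral_gap \<beta> \<omega> p a = 1 \<longleftrightarrow>
      (\<forall>l. a $ l > 0 \<longrightarrow> (\<forall>i j. \<exists>m::int. \<omega> $ l * (p $ i - p $ j) = 2 * pi * of_int m))"
    if "\<beta> > 0"
  proof -
    have "spectral_gap \<beta> \<omega> p a = 1 \<longleftrightarrow> (\<Sum>i\<in>UNIV. W $ i $ i / (\<Sum>k\<in>UNIV. W $ i $ k)) = 1"
      using eigval(6) by (simp add: gap trace)
    also have "\<dots> \<longleftrightarrow> (\<forall>i j. W $ i $ j = exp \<beta>)"
      using c_le that by (intro sum_diagonal_over_row_sum_eq_1_iff Wpos) (simp_all add: W c_def sum_a)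
    also have "\<dots> \<longleftrightarrow> (\<forall>i j. c i j = 1)"
      using that by (simp add: W)
    finally show ?thesis unfolding c_eq by blast
  qed

  have "rope_field \<beta> \<omega> p (consensus x) = 0"
    using x by (simp add: rope_field_def consensus_def dot_square_norm vec_eq_iff)
  moreover have "CARD('m) = 2 * CARD('r) - 1"
    if "orthonormal_basis u (sphere_tangent x)" for u :: "'m \<Rightarrow> real^2^'r"
    using orthonormal_basis_card[OF that] dim_sphere_tangent[OF \<open>x \<noteq> 0\<close>] by (simp add: mult.commute)
  moreover have "is_tangent_jacobian (rope_field \<beta> \<omega> p) x u (kronecker (A - mat 1) (mat 1))"
    if "orthonormal_basis u (sphere_tangent x)" for u :: "'m \<Rightarrow> real^2^'r"
    unfolding assms(4,6) by (rule tangent_jacobian_consensus[OF x that])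
  moreover have "spectral_gap \<beta> \<omega> p a \<in> {0<..1}"
    using eigval(3) eigval(5)[of 2] assms(1) by (simp add: gap)
  ultimately show ?thesis
    using psdW simAS psdS eigval(1-4) eigval(5)[of "CARD('n)"] assms(1) gap_eq_1 by blast
qed

end
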